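(* Let $k_0\in D$ and $\tilde w_{k_0}\in\mathbb R$. Let $(\bar w^*,\bar b^*,\bar\xi^*,\bar z^* )$ be an optimal solution of $(\overline{\mathrm{Re}\text{-}\mathrm{RL}\text{-}\ell_2})_{k_0}$ with $\bar w^*_{k_0}=0$, let $Z_{k_0}$ be its objective value, and let $\bar\alpha=(\bar\alpha_1,\dots,\bar\alpha_n)$ be a vector of optimal values of the dual variables associated with the constraints (A). Let $\hat w_{k_0}\in\mathbb R$ be a constant. If $(\bar w',\bar b',\bar\xi',\bar z')$ is an optimal solution of $(\overline{\mathrm{Re}\text{-}\mathrm{RL}\text{-}\ell_2})_{k_0}$ with the additional restriction $\bar w_{k_0}=\hat w_{k_0}$, and $Z_{\hat k_0}$ is its objective value, then $$Z_{k_0}+\hat w_{k_0}\left(\tfrac12\hat w_{k_0}+\tilde w_{k_0}-\sum_{i=1}^n\bar\alpha_iy_ix_{ik_0}\right)\le Z_{\hat k_0}.$$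
   Context: Data: $N=\{1,\dots,n\}$, $D=\{1,\dots,d\}$, $x_i\in\mathbb R^d$, $y_i\in\{-1,1\}$ for $i\in N$, a constant $C\ge0$, and big-M constants $M_i$ ($i\in N$). $(\mathrm{Re}\text{-}\mathrm{RL}\text{-}\ell_2)$: minimize $\frac12\sum_{k=1}^dw_k^2+C\left(\sum_{i=1}^n\xi_i+2\sum_{i=1}^nz_i\right)$ over $w\in\mathbb R^d$, $b\in\mathbb R$, $\xi,z\in\mathbb R^n$ subject to $0\le\xi_i\le2$, $\xi_i\le2(1-z_i)$, $0\le z_i\le1$ and $y_i\left(\sum_{k=1}^dw_kx_{ik}+b\right)\ge1-\xi_i-M_iz_i$ ($i\in N$). $(\overline{\mathrm{Re}\text{-}\mathrm{RL}\text{-}\ell_2})_{k_0}$ is obtained from it by the change of variables $\bar w_{k_0}=w_{k_0}-\tilde w_{k_0}$, $\bar w_k=w_k$ for $k\neq k_0$: minimize $\frac12\sum_{k=1}^d\bar w_k^2+C\left(\sum_{i=1}^n\bar\xi_i+2\sum_{i=1}^n\bar z_i\right)+\frac12\tilde w_{k_0}^2+\tilde w_{k_0}\bar w_{k_0}$ subject to $\bar\xi_i\le2(1-\bar z_i)$, $0\le\bar\xi_i\le2$, $0\le\bar z_i\le1$, and (A) $y_i\left(\sum_{k=1}^d\bar w_kx_{ik}+\bar b\right)\ge1-\bar\xi_i-y_i\tilde w_{k_0}x_{ik_0}-M_i\bar z_i$ ($i\in N$). The dual variables of the constraints (A) are taken non-negative. *)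

theory Defs
  imports "HOL-Analysis.Analysis"
begin

text \<open>
  Data: the index types \<open>'n\<close> and \<open>'d\<close> play the roles of \<open>N\<close> and \<open>D\<close>; \<open>x $ i $ k\<close> is feature \<open>k\<close> of
  observation \<open>i\<close>, \<open>y $ i\<close> its label, \<open>M $ i\<close> its big-M constant, and \<open>wt\<close> is the shift of
  coordinate \<open>k0\<close>. A point is a tuple \<open>(w, b, \<xi>, z)\<close> of the shifted variables.
\<close>

type_synonym ('d, 'n) point = "(real ^ 'd) \<times> real \<times> (real ^ 'n) \<times> (real ^ 'n)"

definition objective :: "real \<Rightarrow> 'd \<Rightarrow> real \<Rightarrow> ('d::finite, 'n::finite) point \<Rightarrow> real" where
  "objective C k0 wt = (\<lambda>(w, b, \<xi>, z).
     1/2 * (\<Sum>k\<in>UNIV. (w $ k)\<^sup>2) + C * ((\<Sum>i\<in>UNIV. \<xi> $ i) + 2 * (\<Sum>i\<in>UNIV. z $ i))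
     + 1/2 * wt\<^sup>2 + wt * w $ k0)"

definition feasible ::
  "real ^ 'd ^ 'n \<Rightarrow> real ^ 'n \<Rightarrow> real ^ 'n \<Rightarrow> 'd \<Rightarrow> real \<Rightarrow> ('d::finite, 'n::finite) point \<Rightarrow> bool"
where
  "feasible x y M k0 wt = (\<lambda>(w, b, \<xi>, z).
     \<forall>i. \<xi> $ i \<le> 2 * (1 - z $ i) \<and> 0 \<le> \<xi> $ i \<and> \<xi> $ i \<le> 2 \<and> 0 \<le> z $ i \<and> z $ i \<le> 1 \<and>
         y $ i * ((\<Sum>k\<in>UNIV. w $ k * x $ i $ k) + b)
           \<ge> 1 - \<xi> $ i - y $ i * wt * x $ i $ k0 - M $ i * z $ i)"

text \<open>
  One multiplier vector per constraint family: \<open>\<alpha>\<close> for the margin constraints (the last family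
  in \<open>feasible\<close>), then \<open>\<beta>\<close> for \<open>\<xi> \<le> 2 (1 - z)\<close>, \<open>\<gamma>\<close> for \<open>0 \<le> \<xi>\<close>, \<open>\<delta>\<close> for \<open>\<xi> \<le> 2\<close>, \<open>\<mu>\<close> for \<open>0 \<le> z\<close> and
  \<open>\<nu>\<close> for \<open>z \<le> 1\<close>. Each constraint is written as \<open>g \<le> 0\<close> and enters the Lagrangian with a
  non-negative multiplier.
\<close>

type_synonym 'n multipliers =
  "(real ^ 'n) \<times> (real ^ 'n) \<times> (real ^ 'n) \<times> (real ^ 'n) \<times> (real ^ 'n) \<times> (real ^ 'n)"

definition lagrangian ::
  "real ^ 'd ^ 'n \<Rightarrow> real ^ 'n \<Rightarrow> real ^ 'n \<Rightarrow> real \<Rightarrow> 'd \<Rightarrow> real \<Rightarrow>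
   'n multipliers \<Rightarrow> ('d::finite, 'n::finite) point \<Rightarrow> real"
where
  "lagrangian x y M C k0 wt = (\<lambda>(\<alpha>, \<beta>, \<gamma>, \<delta>, \<mu>, \<nu>) (w, b, \<xi>, z).
     objective C k0 wt (w, b, \<xi>, z)
     + (\<Sum>i\<in>UNIV. \<alpha> $ i * (1 - \<xi> $ i - y $ i * wt * x $ i $ k0 - M $ i * z $ i
                            - y $ i * ((\<Sum>k\<in>UNIV. w $ k * x $ i $ k) + b)))
     + (\<Sum>i\<in>UNIV. \<beta> $ i * (\<xi> $ i - 2 * (1 - z $ i)))
     + (\<Sum>i\<in>UNIV. \<gamma> $ i * (- \<xi> $ i))
     + (\<Sum>i\<in>UNIV. \<delta> $ i * (\<xi> $ i - 2))
     + (\<Sum>i\<in>UNIV. \<mu> $ i * (- z $ i))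
     + (\<Sum>i\<in>UNIV. \<nu> $ i * (z $ i - 1)))"

definition dual_function ::
  "real ^ 'd ^ 'n \<Rightarrow> real ^ 'n \<Rightarrow> real ^ 'n \<Rightarrow> real \<Rightarrow> 'd::finite \<Rightarrow> real \<Rightarrow>
   'n::finite multipliers \<Rightarrow> ereal"
where
  "dual_function x y M C k0 wt m = (INF p. ereal (lagrangian x y M C k0 wt m p))"

definition dual_feasible :: "'n::finite multipliers \<Rightarrow> bool" where
  "dual_feasible = (\<lambda>(\<alpha>, \<beta>, \<gamma>, \<delta>, \<mu>, \<nu>).
     \<forall>i. 0 \<le> \<alpha> $ i \<and> 0 \<le> \<beta> $ i \<and> 0 \<le> \<gamma> $ i \<and> 0 \<le> \<delta> $ i \<and> 0 \<le> \<mu> $ i \<and> 0 \<le> \<nu> $ i)"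

text \<open>\<open>\<alpha>\<close> is the margin-constraint part of some optimal solution of the Lagrangian dual.\<close>

definition optimal_margin_duals ::
  "real ^ 'd ^ 'n \<Rightarrow> real ^ 'n \<Rightarrow> real ^ 'n \<Rightarrow> real \<Rightarrow> 'd::finite \<Rightarrow> real \<Rightarrow> real ^ 'n::finite \<Rightarrow> bool"
where
  "optimal_margin_duals x y M C k0 wt \<alpha> \<longleftrightarrow>
     (\<exists>\<beta> \<gamma> \<delta> \<mu> \<nu>. is_arg_max (dual_function x y M C k0 wt) dual_feasible (\<alpha>, \<beta>, \<gamma>, \<delta>, \<mu>, \<nu>))"

end

theory Submission
  imports Defs
begin

text \<open>
  The objective is convex and differentiable and all constraints are affine, so by Farkas' lemma an
  optimal solution has Karush--Kuhn--Tucker multipliers without any constraint qualification.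
  Hence the optimal value of the Lagrangian dual is at least \<open>Z\<close>, and the Lagrangian at the given
  optimal multipliers is bounded below by \<open>Z\<close> everywhere. The Lagrangian is separable in
  coordinate \<open>k0\<close> of \<open>w\<close>: replacing the value \<open>wh\<close> by \<open>0\<close> at the restricted solution
  changes it by exactly the correction term of the bound, while weak duality bounds the Lagrangian
  at the restricted solution by \<open>Zh\<close>.
\<close>

section \<open>Multipliers for convex minimization under affine constraints\<close>

text \<open>A finitely generated convex cone is closed, so a vector \<open>g\<close> outside it is
  strictly separated from it by a hyperplane, and the negated normal violates the hypothesis on
  \<open>g\<close>. The set \<open>S\<close> supplies the explicit non-negative combinations for
  members of the cone.\<close>

lemma Farkas:
  fixes a :: "'j \<Rightarrow> 'a::euclidean_space"
  assumes "finite J"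
    and g: "\<And>v. (\<And>j. j \<in> J \<Longrightarrow> a j \<bullet> v \<le> 0) \<Longrightarrow> g \<bullet> v \<le> 0"
  obtains u :: "'j \<Rightarrow> real" where "\<And>j. j \<in> J \<Longrightarrow> 0 \<le> u j" "g = (\<Sum>j\<in>J. u j *\<^sub>R a j)"
proof -
  let ?K = "convex_cone hull (a ` J)"
  define S where "S = {v. \<exists>u. (\<forall>j\<in>J. 0 \<le> u j) \<and> v = (\<Sum>j\<in>J. u j *\<^sub>R a j)}"
  have S_I: "(\<Sum>j\<in>J. u j *\<^sub>R a j) \<in> S" if "\<And>j. j \<in> J \<Longrightarrow> 0 \<le> u j" for u
    using that unfolding S_def by blast
  have S_E: thesis
    if "v \<in> S" "\<And>u. \<lbrakk>\<And>j. j \<in> J \<Longrightarrow> 0 \<le> u j; v = (\<Sum>j\<in>J. u j *\<^sub>R a j)\<rbrakk> \<Longrightarrow> thesis" for v thesis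
    using that unfolding S_def by blast
  have "?K \<subseteq> S"
  proof (rule hull_minimal)
    show "a ` J \<subseteq> S"
    proof (rule image_subsetI)
      fix j assume "j \<in> J"
      have "(\<Sum>i\<in>J. (if i = j then 1 else 0) *\<^sub>R a i) = (\<Sum>i\<in>J. if i = j then a i else 0)"
        by (rule sum.cong) auto
      also have "\<dots> = a j"
        using \<open>finite J\<close> \<open>j \<in> J\<close> by simp
      finally show "a j \<in> S"
        using S_I[of "\<lambda>i. if i = j then 1 else 0"] by simp
    qed
    have "0 \<in> S"
      using S_I[of "\<lambda>_. 0"] by simp
    moreover have "v + v' \<in> S" if v: "v \<in> S" and v': "v' \<in> S" for v v'
    proof (rule S_E[OF v], rule S_E[OF v'])
      fix u u' :: "'j \<Rightarrow> real"
      assume "\<And>j. j \<in> J \<Longrightarrow> 0 \<le> u j" "v = (\<Sum>j\<in>J. u j *\<^sub>R a j)"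
        "\<And>j. j \<in> J \<Longrightarrow> 0 \<le> u' j" "v' = (\<Sum>j\<in>J. u' j *\<^sub>R a j)"
      then show ?thesis
        using S_I[of "\<lambda>j. u j + u' j"] by (simp add: scaleR_add_left sum.distrib)
    qed
    moreover have "c *\<^sub>R v \<in> S" if v: "v \<in> S" and "0 \<le> c" for v c
    proof (rule S_E[OF v])
      fix u :: "'j \<Rightarrow> real"
      assume "\<And>j. j \<in> J \<Longrightarrow> 0 \<le> u j" "v = (\<Sum>j\<in>J. u j *\<^sub>R a j)"
      then show ?thesis
        using \<open>0 \<le> c\<close> S_I[of "\<lambda>j. c * u j"] by (simp add: scaleR_sum_right)
    qed
    ultimately show "convex_cone S"
      unfolding convex_cone_iff by blast
  qed
  moreover have "g \<in> ?K"
  proof (rule ccontr)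
    assume "g \<notin> ?K"
    then obtain h b where h: "h \<bullet> g < b" "\<And>v. v \<in> ?K \<Longrightarrow> b < h \<bullet> v"
      using separating_hyperplane_closed_point[of ?K g] \<open>finite J\<close>
      by (auto simp: closed_convex_cone_hull convex_convex_cone_hull)
    have "b < 0"
      using h(2)[OF convex_cone_hull_contains_0] by simp
    have "a j \<bullet> (- h) \<le> 0" if "j \<in> J" for j
    proof (rule ccontr)
      assume "\<not> a j \<bullet> (- h) \<le> 0"
      then have neg: "h \<bullet> a j < 0"
        by (simp add: inner_commute)
      \<comment> \<open>The factor is chosen so that \<open>h\<close> takes exactly the value
        \<open>b\<close> on this multiple, against the strict inequality on the cone.\<close>
      have "(b / (h \<bullet> a j)) *\<^sub>R a j \<in> ?K"
        using neg \<open>b < 0\<close> \<open>j \<in> J\<close>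
        by (intro convex_cone_hull_mul hull_inc) (auto simp: divide_nonpos_neg)
      from h(2)[OF this] neg show False
        by simp
    qed
    from g[OF this] h(1) \<open>b < 0\<close> show False
      by (simp add: inner_commute)
  qed
  ultimately show thesis
    using S_E[of g] that by blast
qed

text \<open>The limit is one-sided because the directions used below are feasible only for small
  positive \<open>t\<close>.\<close>

lemma has_derivative_tendsto_at_right:
  fixes f :: "'a::real_normed_vector \<Rightarrow> real"
  assumes "(f has_derivative f') (at p)"
  shows "((\<lambda>t. (f (p + t *\<^sub>R v) - f p) / t) \<longlongrightarrow> f' v) (at_right 0)"
proof -
  have "((\<lambda>t. f (p + t *\<^sub>R v)) has_derivative (\<lambda>t. f' (t *\<^sub>R v))) (at 0)"
    by (rule has_derivative_compose[where f = "\<lambda>t. p + t *\<^sub>R v", simplified])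
      (auto intro!: derivative_eq_intros assms)
  moreover have "f' (t *\<^sub>R v) = f' v * t" for t
    using linear_scale[OF has_derivative_linear[OF assms]] by simp
  ultimately have "((\<lambda>t. f (p + t *\<^sub>R v)) has_field_derivative f' v) (at 0)"
    by (simp add: has_field_derivative_def)
  then show ?thesis
    by (auto simp: DERIV_def intro: filterlim_mono[OF _ order_refl at_le])
qed

text \<open>At a minimizer, \<open>f'\<close> is non-negative in every direction that increases no
  active constraint. Farkas' lemma then writes the negative gradient as a non-negative combination
  of the active constraint normals, and the subgradient inequality turns this local stationarity
  into a bound on the Lagrangian at every \<open>q\<close>.\<close>

lemma affine_constraints_multipliers:
  fixes f :: "'a::euclidean_space \<Rightarrow> real" and l :: "'j \<Rightarrow> 'a \<Rightarrow> real"
  assumes J: "finite J" and l: "\<And>j. j \<in> J \<Longrightarrow> linear (l j)"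
    and f': "(f has_derivative f') (at p)"
    and subgradient: "\<And>q. f p + f' (q - p) \<le> f q"
    and feas: "\<And>j. j \<in> J \<Longrightarrow> l j p \<le> c j"
    and min: "\<And>q. (\<And>j. j \<in> J \<Longrightarrow> l j q \<le> c j) \<Longrightarrow> f p \<le> f q"
  obtains u :: "'j \<Rightarrow> real" where "\<And>j. j \<in> J \<Longrightarrow> 0 \<le> u j"
    "\<And>q. f p \<le> f q + (\<Sum>j\<in>J. u j * (l j q - c j))"
proof -
  \<comment> \<open>These are the active constraints; the others are strict at \<open>p\<close> and
    so survive a small step in any direction.\<close>
  define A where "A = {j \<in> J. l j p = c j}"
  have "A \<subseteq> J" "finite A"
    using J by (auto simp: A_def)
  have lin_f': "linear f'"
    using f' by (rule has_derivative_linear)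
  \<comment> \<open>The adjoint at 1 is the vector representing a linear functional by the inner
    product, which is the form that \<open>Farkas\<close> expects.\<close>
  have l_adj: "adjoint (l j) 1 \<bullet> v = l j v" if "j \<in> J" for j v
    using adjoint_works[OF l[OF that], of v 1] by (simp add: inner_commute)
  have f'_adj: "adjoint f' 1 \<bullet> v = f' v" for v
    using adjoint_works[OF lin_f', of v 1] by (simp add: inner_commute)
  have f'_nonneg: "0 \<le> f' v" if v: "\<And>j. j \<in> A \<Longrightarrow> l j v \<le> 0" for v
  proof (rule tendsto_lowerbound[OF has_derivative_tendsto_at_right[OF f']])
    have "\<forall>\<^sub>F t in at_right 0. l j (p + t *\<^sub>R v) \<le> c j" if "j \<in> J" for j
    proof -
      have eq: "l j (p + t *\<^sub>R v) = l j p + t * l j v" for t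
        using l[OF that] by (simp add: linear_add linear_scale)
      show ?thesis
      proof (cases "j \<in> A")
        case True
        then show ?thesis
          using v[OF True] eventually_at_right_less[of "0::real"] unfolding eq A_def
          by (auto elim!: eventually_mono simp: mult_nonneg_nonpos)
      next
        case False
        then have "l j p < c j"
          using feas[OF that] that by (auto simp: A_def)
        moreover have "((\<lambda>t. l j p + t * l j v) \<longlongrightarrow> l j p + 0 * l j v) (at_right 0)"
          by (intro tendsto_intros)
        ultimately have "\<forall>\<^sub>F t in at_right 0. l j p + t * l j v < c j"
          by (intro order_tendstoD) auto
        then show ?thesis
          unfolding eq by (rule eventually_mono) simp
      qed
    qed
    then have "\<forall>\<^sub>F t in at_right 0. \<forall>j\<in>J. l j (p + t *\<^sub>R v) \<le> c j"
      using J by (simp add: eventually_ball_finite)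
    with eventually_at_right_less[of "0::real"]
    show "\<forall>\<^sub>F t in at_right 0. 0 \<le> (f (p + t *\<^sub>R v) - f p) / t"
    proof eventually_elim
      case (elim t)
      then have "f p \<le> f (p + t *\<^sub>R v)"
        by (intro min) blast
      with \<open>0 < t\<close> show ?case
        by simp
    qed
  qed simp
  have dir: "- adjoint f' 1 \<bullet> v \<le> 0"
    if "\<And>j. j \<in> A \<Longrightarrow> adjoint (l j) 1 \<bullet> v \<le> 0" for v
  proof -
    have "l j v \<le> 0" if "j \<in> A" for j
      using \<open>\<And>j. j \<in> A \<Longrightarrow> adjoint (l j) 1 \<bullet> v \<le> 0\<close>[OF that] l_adj that \<open>A \<subseteq> J\<close> by auto
    from f'_nonneg[OF this] show ?thesis
      by (simp add: f'_adj)
  qed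
  obtain u where u: "\<And>j. j \<in> A \<Longrightarrow> 0 \<le> u j"
    "- adjoint f' 1 = (\<Sum>j\<in>A. u j *\<^sub>R adjoint (l j) 1)"
    using Farkas[of A "\<lambda>j. adjoint (l j) 1" "- adjoint f' 1", OF \<open>finite A\<close>] dir by metis
  show thesis
  \<comment> \<open>Complementary slackness: inactive constraints get multiplier 0. For active ones,
    \<open>l j p = c j\<close> turns \<open>l j (q - p)\<close> into
    \<open>l j q - c j\<close>.\<close>
  proof (rule that[of "\<lambda>j. if j \<in> A then u j else 0"])
    fix q
    have "- f' (q - p) = (\<Sum>j\<in>A. u j *\<^sub>R adjoint (l j) 1) \<bullet> (q - p)"
      by (simp flip: u(2) add: f'_adj)
    also have "\<dots> = (\<Sum>j\<in>A. u j * (l j q - c j))"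
      unfolding inner_sum_left
    proof (rule sum.cong)
      fix j assume "j \<in> A"
      then have "l j p = c j" "j \<in> J"
        by (auto simp: A_def)
      then show "u j *\<^sub>R adjoint (l j) 1 \<bullet> (q - p) = u j * (l j q - c j)"
        using linear_diff[OF l[OF \<open>j \<in> J\<close>], of q p] by (simp add: l_adj)
    qed simp
    also have "\<dots> = (\<Sum>j\<in>J. (if j \<in> A then u j else 0) * (l j q - c j))"
      using \<open>A \<subseteq> J\<close> J by (intro sum.mono_neutral_cong_left) auto
    finally show "f p \<le> f q + (\<Sum>j\<in>J. (if j \<in> A then u j else 0) * (l j q - c j))"
      using subgradient[of q] by simp
  qed (auto simp: u(1))
qed

section \<open>The problem as an instance of the abstract setting\<close>

definition objective_derivative ::
  "real \<Rightarrow> 'd \<Rightarrow> real \<Rightarrow> ('d::finite, 'n::finite) point \<Rightarrow> ('d, 'n) point \<Rightarrow> real" where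
  "objective_derivative C k0 wt = (\<lambda>(w, b, \<xi>, z) (w', b', \<xi>', z').
     (\<Sum>k\<in>UNIV. w $ k * w' $ k) + C * ((\<Sum>i\<in>UNIV. \<xi>' $ i) + 2 * (\<Sum>i\<in>UNIV. z' $ i))
     + wt * w' $ k0)"

lemma has_derivative_vec_nth [derivative_intros]:
  "(f has_derivative f') F \<Longrightarrow> ((\<lambda>x. f x $ i) has_derivative (\<lambda>x. f' x $ i)) F"
  by (rule bounded_linear.has_derivative[OF bounded_linear_vec_nth])

lemma has_derivative_objective:
  "(objective C k0 wt has_derivative objective_derivative C k0 wt p) (at p)"
  unfolding objective_def objective_derivative_def case_prod_beta
  by (auto intro!: derivative_eq_intros simp: fun_eq_iff sum_distrib_left algebra_simps)

text \<open>Only the squares are not affine; for each of them the gap to the tangent is half the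
  square of the difference.\<close>

lemma objective_subgradient:
  "objective C k0 wt p + objective_derivative C k0 wt p (q - p) \<le> objective C k0 wt q"
proof -
  obtain w b \<xi> z w' b' \<xi>' z' where pq: "p = (w, b, \<xi>, z)" "q = (w', b', \<xi>', z')"
    by (metis prod_cases4)
  have "w $ k * (w' $ k - w $ k) \<le> 1/2 * (w' $ k)\<^sup>2 - 1/2 * (w $ k)\<^sup>2" for k
    using zero_le_power2[of "w' $ k - w $ k"] by (simp add: power2_eq_square algebra_simps)
  then have "(\<Sum>k\<in>UNIV. w $ k * (w' $ k - w $ k))
      \<le> (\<Sum>k\<in>UNIV. 1/2 * (w' $ k)\<^sup>2 - 1/2 * (w $ k)\<^sup>2)"
    by (rule sum_mono)
  then show ?thesis
    unfolding pq
    by (simp add: objective_def objective_derivative_def sum_subtractf sum_distrib_left algebra_simps)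
qed

text \<open>The constraint families are numbered in the order of their multipliers.\<close>

definition constraint_form ::
  "real ^ 'd ^ 'n \<Rightarrow> real ^ 'n \<Rightarrow> real ^ 'n \<Rightarrow> nat \<times> 'n \<Rightarrow> ('d::finite, 'n::finite) point \<Rightarrow> real"
where
  "constraint_form x y M = (\<lambda>(m, i) (w, b, \<xi>, z).
     [- \<xi> $ i - M $ i * z $ i - y $ i * ((\<Sum>k\<in>UNIV. w $ k * x $ i $ k) + b),
      \<xi> $ i + 2 * z $ i, - \<xi> $ i, \<xi> $ i, - z $ i, z $ i] ! m)"

text \<open>The constant part of each constraint is moved to this side, so that the other side is
  linear and not merely affine.\<close>

definition constraint_bound ::
  "real ^ 'd ^ 'n \<Rightarrow> real ^ 'n \<Rightarrow> 'd \<Rightarrow> real \<Rightarrow> nat \<times> 'n \<Rightarrow> real"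
where
  "constraint_bound x y k0 wt = (\<lambda>(m, i). [y $ i * wt * x $ i $ k0 - 1, 2, 0, 2, 0, 1] ! m)"

abbreviation constraint_index :: "(nat \<times> 'n) set" where
  "constraint_index \<equiv> {0, 1, 2, 3, 4, 5} \<times> UNIV"

lemma linear_constraint_form:
  "j \<in> constraint_index \<Longrightarrow> linear (constraint_form x y M j)"
  by (rule linearI)
    (auto simp: constraint_form_def case_prod_beta sum.distrib sum_distrib_left algebra_simps)

lemma feasible_iff_constraint_form:
  "feasible x y M k0 wt p \<longleftrightarrow>
     (\<forall>j\<in>constraint_index. constraint_form x y M j p \<le> constraint_bound x y k0 wt j)"
  by (cases p) (auto simp: feasible_def constraint_form_def constraint_bound_def algebra_simps)

lemma lagrangian_eq_constraint_form:
  "lagrangian x y M C k0 wt (\<chi> i. u (0, i), \<chi> i. u (1, i), \<chi> i. u (2, i), \<chi> i. u (3, i),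
       \<chi> i. u (4, i), \<chi> i. u (5, i)) p
   = objective C k0 wt p
     + (\<Sum>j\<in>constraint_index. u j * (constraint_form x y M j p - constraint_bound x y k0 wt j))"
  by (cases p) (simp add: lagrangian_def constraint_form_def constraint_bound_def
      sum.cartesian_product' algebra_simps)

section \<open>Strong and weak duality\<close>

lemma optimal_multipliers_exist:
  assumes "is_arg_min (objective C k0 wt) (feasible x y M k0 wt) p"
  obtains m where "dual_feasible m"
    "\<And>q. objective C k0 wt p \<le> lagrangian x y M C k0 wt m q"
proof -
  let ?l = "constraint_form x y M" and ?c = "constraint_bound x y k0 wt"
  have p: "?l j p \<le> ?c j" if "j \<in> constraint_index" for j
    using assms that unfolding is_arg_min_linorder feasible_iff_constraint_form by blast
  have min: "objective C k0 wt p \<le> objective C k0 wt q"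
    if "\<And>j. j \<in> constraint_index \<Longrightarrow> ?l j q \<le> ?c j" for q
    using assms that unfolding is_arg_min_linorder feasible_iff_constraint_form by blast
  show thesis
  proof (rule affine_constraints_multipliers[where J = constraint_index and l = ?l and c = ?c,
        OF _ linear_constraint_form has_derivative_objective objective_subgradient p min])
    fix u
    assume u: "\<And>j. j \<in> constraint_index \<Longrightarrow> 0 \<le> u j"
      "\<And>q. objective C k0 wt p
        \<le> objective C k0 wt q + (\<Sum>j\<in>constraint_index. u j * (?l j q - ?c j))"
    let ?m = "(\<chi> i. u (0, i), \<chi> i. u (1, i), \<chi> i. u (2, i), \<chi> i. u (3, i),
      \<chi> i. u (4, i), \<chi> i. u (5, i))"
    have "dual_feasible ?m"
      using u(1) by (simp add: dual_feasible_def)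
    moreover have "objective C k0 wt p \<le> lagrangian x y M C k0 wt ?m q" for q
      unfolding lagrangian_eq_constraint_form by (rule u(2))
    ultimately show thesis
      by (rule that)
  qed simp_all
qed

lemma lagrangian_ge_optimal_value:
  assumes opt: "is_arg_min (objective C k0 wt) (feasible x y M k0 wt) p"
    and m: "is_arg_max (dual_function x y M C k0 wt) dual_feasible m"
  shows "objective C k0 wt p \<le> lagrangian x y M C k0 wt m q"
proof -
  obtain m' where m': "dual_feasible m'"
    "\<And>q. objective C k0 wt p \<le> lagrangian x y M C k0 wt m' q"
    using optimal_multipliers_exist[OF opt] by blast
  \<comment> \<open>The comparison runs in \<open>ereal\<close>, since an infimum of the Lagrangian
    may be minus infinity. The multipliers \<open>m'\<close> serve only to bound the dual optimum
    attained at \<open>m\<close> from below.\<close>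
  have "ereal (objective C k0 wt p) \<le> dual_function x y M C k0 wt m'"
    unfolding dual_function_def by (rule INF_greatest) (simp add: m'(2))
  also have "\<dots> \<le> dual_function x y M C k0 wt m"
    using m m'(1) unfolding is_arg_max_linorder by blast
  also have "\<dots> \<le> ereal (lagrangian x y M C k0 wt m q)"
    unfolding dual_function_def by (rule INF_lower) simp
  finally show ?thesis
    by simp
qed

text \<open>Weak duality: each of the six penalty sums pairs non-negative multipliers with
  non-positive constraint values.\<close>

lemma lagrangian_le_objective:
  fixes m :: "'n::finite multipliers"
  assumes "dual_feasible m" "feasible x y M k0 wt p"
  shows "lagrangian x y M C k0 wt m p \<le> objective C k0 wt p"
proof -
  obtain \<alpha> \<beta> \<gamma> \<delta> \<mu> \<nu> w b \<xi> z where mp: "m = (\<alpha>, \<beta>, \<gamma>, \<delta>, \<mu>, \<nu>)" "p = (w, b, \<xi>, z)"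
    by (metis prod_cases4 prod_cases6)
  have *: "(\<Sum>i\<in>UNIV. v $ i * g i) \<le> 0" if "\<And>i. 0 \<le> v $ i" "\<And>i. g i \<le> 0"
    for v :: "real ^ 'n" and g
    using that by (intro sum_nonpos mult_nonneg_nonpos)
  show ?thesis
    using assms unfolding mp lagrangian_def prod.case
    by (intro add_decreasing2 * order_refl)
      (auto simp: dual_feasible_def feasible_def algebra_simps)
qed

text \<open>The coordinate \<open>w $ k0\<close> enters only through its square, the term with
  \<open>wt\<close> and the margin constraints, and in no product with another primal variable;
  collecting these terms gives the correction.\<close>

lemma lagrangian_separable:
  fixes w :: "real ^ 'd::finite"
  shows "lagrangian x y M C k0 wt (\<alpha>, \<beta>, \<gamma>, \<delta>, \<mu>, \<nu>) (w, b, \<xi>, z)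
   = lagrangian x y M C k0 wt (\<alpha>, \<beta>, \<gamma>, \<delta>, \<mu>, \<nu>) (\<chi> k. if k = k0 then 0 else w $ k, b, \<xi>, z)
     + w $ k0 * (1/2 * w $ k0 + wt - (\<Sum>i\<in>UNIV. \<alpha> $ i * y $ i * x $ i $ k0))"
proof -
  let ?w = "\<chi> k. if k = k0 then 0 else w $ k"
  have sq: "(\<Sum>k\<in>UNIV. (w $ k)\<^sup>2) = (w $ k0)\<^sup>2 + (\<Sum>k\<in>UNIV. (?w $ k)\<^sup>2)"
    by (simp add: sum.remove[of UNIV k0])
  have lin: "(\<Sum>k\<in>UNIV. w $ k * v $ k) = w $ k0 * v $ k0 + (\<Sum>k\<in>UNIV. ?w $ k * v $ k)"
    for v :: "real ^ 'd"
    by (simp add: sum.remove[of UNIV k0])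
  have "(\<Sum>i\<in>UNIV. \<alpha> $ i * (1 - \<xi> $ i - y $ i * wt * x $ i $ k0 - M $ i * z $ i
          - y $ i * ((\<Sum>k\<in>UNIV. w $ k * x $ i $ k) + b)))
      = (\<Sum>i\<in>UNIV. \<alpha> $ i * (1 - \<xi> $ i - y $ i * wt * x $ i $ k0 - M $ i * z $ i
          - y $ i * ((\<Sum>k\<in>UNIV. ?w $ k * x $ i $ k) + b)))
        - w $ k0 * (\<Sum>i\<in>UNIV. \<alpha> $ i * y $ i * x $ i $ k0)"
    unfolding lin sum_distrib_left sum_subtractf[symmetric]
    by (rule sum.cong) (auto simp: algebra_simps)
  then show ?thesis
    unfolding lagrangian_def objective_def prod.case sq
    by (simp add: power2_eq_square algebra_simps)
qed

theorem theorem4p1: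
  fixes x :: "real ^ 'd::finite ^ 'n::finite"
    and y M :: "real ^ 'n"
    and C wt wh Z Zh :: real
    and k0 :: 'd
    and w w' :: "real ^ 'd"
    and b b' :: real
    and \<xi> z \<xi>' z' \<alpha> :: "real ^ 'n"
  assumes labels: "\<And>i. y $ i \<in> {-1, 1}"
    and C_nonneg: "0 \<le> C"
    and opt: "is_arg_min (objective C k0 wt) (feasible x y M k0 wt) (w, b, \<xi>, z)"
    and w_k0: "w $ k0 = 0"
    and Z: "Z = objective C k0 wt (w, b, \<xi>, z)"
    and dual: "optimal_margin_duals x y M C k0 wt \<alpha>"
    and opt': "is_arg_min (objective C k0 wt)
                 (\<lambda>p. feasible x y M k0 wt p \<and> fst p $ k0 = wh) (w', b', \<xi>', z')"
    and Zh: "Zh = objective C k0 wt (w', b', \<xi>', z')"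
  shows "Z + wh * (1/2 * wh + wt - (\<Sum>i\<in>UNIV. \<alpha> $ i * y $ i * x $ i $ k0)) \<le> Zh"
proof -
  obtain \<beta> \<gamma> \<delta> \<mu> \<nu> where
    m: "is_arg_max (dual_function x y M C k0 wt) dual_feasible (\<alpha>, \<beta>, \<gamma>, \<delta>, \<mu>, \<nu>)"
    using dual unfolding optimal_margin_duals_def by blast
  have feas': "feasible x y M k0 wt (w', b', \<xi>', z')" and w': "w' $ k0 = wh"
    using opt' by (auto simp: is_arg_min_def)
  have "lagrangian x y M C k0 wt (\<alpha>, \<beta>, \<gamma>, \<delta>, \<mu>, \<nu>) (w', b', \<xi>', z') \<le> Zh"
    unfolding Zh using m feas' by (intro lagrangian_le_objective) (simp_all add: is_arg_max_def)
  \<comment> \<open>The point with coordinate \<open>k0\<close> set to 0 need not be feasible, but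
    the lower bound \<open>Z\<close> on the Lagrangian holds at every point.\<close>
  moreover have "Z \<le> lagrangian x y M C k0 wt (\<alpha>, \<beta>, \<gamma>, \<delta>, \<mu>, \<nu>)
      (\<chi> k. if k = k0 then 0 else w' $ k, b', \<xi>', z')"
    unfolding Z using opt m by (rule lagrangian_ge_optimal_value)
  ultimately show ?thesis
    unfolding lagrangian_separable[of x y M C k0 wt \<alpha> \<beta> \<gamma> \<delta> \<mu> \<nu> w'] w' by linarith
qed

end
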